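(* Let $F$ be a finite simple graph and let $G$ be a $k$-fold cover of $F$. Then (a) if $F$ is $3$-regular, $\gamma_t(G) \geq \frac{3}{5}\,k\,\gamma_t(F)$; (b) if $F$ is $4$-regular or $5$-regular, $\gamma_t(G) \geq \frac{1}{2}\,k\,\gamma_t(F)$.
   Context: All graphs are finite, simple and undirected. A graph $G$ is a cover of a graph $F$ if there is an onto map $\pi: V(G)\to V(F)$ such that for every vertex $v$ of $G$, $\pi$ maps the neighbours of $v$ in $G$ bijectively onto the neighbours of $\pi(v)$ in $F$; the cover is $k$-fold if every fibre $\pi^{-1}(u)$ has exactly $k$ vertices. A total dominating set of a graph is a set $S$ of vertices such that every vertex of the graph is adjacent to some vertex of $S$; $\gamma_t(\cdot)$ denotes the total domination number, the minimum size of a total dominating set. *)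

theory Defs
  imports Complex_Main
begin

definition simple_graph :: "'a set \<Rightarrow> ('a \<Rightarrow> 'a \<Rightarrow> bool) \<Rightarrow> bool" where
  "simple_graph V E \<longleftrightarrow> finite V \<and> (\<forall>x y. E x y \<longrightarrow> x \<in> V \<and> y \<in> V)
     \<and> (\<forall>x y. E x y \<longrightarrow> E y x) \<and> (\<forall>x. \<not> E x x)"

definition nbhd :: "'a set \<Rightarrow> ('a \<Rightarrow> 'a \<Rightarrow> bool) \<Rightarrow> 'a \<Rightarrow> 'a set" where
  "nbhd V E v = {u \<in> V. E v u}"

definition regular :: "'a set \<Rightarrow> ('a \<Rightarrow> 'a \<Rightarrow> bool) \<Rightarrow> nat \<Rightarrow> bool" where
  "regular V E d \<longleftrightarrow> (\<forall>v\<in>V. card (nbhd V E v) = d)"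

definition is_cover_map ::
  "'a set \<Rightarrow> ('a \<Rightarrow> 'a \<Rightarrow> bool) \<Rightarrow> 'b set \<Rightarrow> ('b \<Rightarrow> 'b \<Rightarrow> bool) \<Rightarrow> ('a \<Rightarrow> 'b) \<Rightarrow> bool" where
  "is_cover_map VG EG VF EF p \<longleftrightarrow> p ` VG = VF \<and>
     (\<forall>v\<in>VG. bij_betw p (nbhd VG EG v) (nbhd VF EF (p v)))"

definition is_k_fold_cover ::
  "nat \<Rightarrow> 'a set \<Rightarrow> ('a \<Rightarrow> 'a \<Rightarrow> bool) \<Rightarrow> 'b set \<Rightarrow> ('b \<Rightarrow> 'b \<Rightarrow> bool) \<Rightarrow> bool" where
  "is_k_fold_cover k VG EG VF EF \<longleftrightarrow> (\<exists>p. is_cover_map VG EG VF EF p \<and>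
     (\<forall>u\<in>VF. card {v \<in> VG. p v = u} = k))"

definition total_dominating_set :: "'a set \<Rightarrow> ('a \<Rightarrow> 'a \<Rightarrow> bool) \<Rightarrow> 'a set \<Rightarrow> bool" where
  "total_dominating_set V E S \<longleftrightarrow> S \<subseteq> V \<and> (\<forall>v\<in>V. \<exists>s\<in>S. E v s)"

definition total_domination_number :: "'a set \<Rightarrow> ('a \<Rightarrow> 'a \<Rightarrow> bool) \<Rightarrow> nat" where
  "total_domination_number V E = Min (card ` {S. total_dominating_set V E S})"

end

theory Submission
  imports Defs
begin

text \<open>
  Counting gives \<open>\<gamma>\<^sub>t(G) \<ge> |V(G)| / d = k n / d\<close> for \<open>n = |V(F)|\<close>, so it suffices to show
  \<open>\<gamma>\<^sub>t(F) \<le> c n\<close> with \<open>c = 5/9, 1/2, 2/5\<close> for \<open>d = 3, 4, 5\<close>. A total dominating set of \<open>F\<close> is a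
  transversal of the \<open>d\<close>-uniform hypergraph of open neighbourhoods. Choosing vertices of maximum
  degree greedily yields a transversal of size at most \<open>\<Sum>v. w (deg v)\<close> for a suitable concave
  weight \<open>w\<close>. For \<open>d = 5\<close> the pure greedy bound is about \<open>0.412 n\<close>; it drops to \<open>2/5 n\<close> once
  hypergraphs of maximum degree 2 are treated separately: dually these are multigraphs, a
  transversal is an edge cover, and a matching without augmenting paths of length 3 is large.
\<close>

section \<open>Greedy transversals with concave degree weights\<close>

definition hdeg :: "'a set set \<Rightarrow> 'a \<Rightarrow> nat" where
  "hdeg E v = card {e \<in> E. v \<in> e}"

text \<open>Set systems suffice: equal neighbourhoods are merged, which only lowers degrees.\<close>

definition transversal_bound :: "'a set \<Rightarrow> nat \<Rightarrow> (nat \<Rightarrow> real) \<Rightarrow> nat \<Rightarrow> bool" where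
  "transversal_bound V r w D \<longleftrightarrow> (\<forall>E. E \<subseteq> Pow V \<and> (\<forall>e\<in>E. card e = r) \<and> (\<forall>v\<in>V. hdeg E v \<le> D) \<longrightarrow>
     (\<exists>T\<subseteq>V. (\<forall>e\<in>E. e \<inter> T \<noteq> {}) \<and> real (card T) \<le> (\<Sum>v\<in>V. w (hdeg E v))))"

lemma double_counting:
  assumes "finite A" "finite B"
  shows "(\<Sum>x\<in>A. card {y \<in> B. R x y}) = (\<Sum>y\<in>B. card {x \<in> A. R x y})"
proof -
  have "(\<Sum>x\<in>A. card {y \<in> B. R x y}) = (\<Sum>x\<in>A. \<Sum>y\<in>B. if R x y then 1 else 0)"
    using assms by (simp add: sum.If_cases Int_def)
  also have "\<dots> = (\<Sum>y\<in>B. \<Sum>x\<in>A. if R x y then 1 else 0)"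
    by (rule sum.swap)
  also have "\<dots> = (\<Sum>y\<in>B. card {x \<in> A. R x y})"
    using assms by (simp add: sum.If_cases Int_def)
  finally show ?thesis .
qed

text \<open>Telescoping: each of the \<open>c\<close> unit steps starts at an index at most
  \<open>D\<close>. Read downwards, a vertex that loses \<open>c\<close> edges loses weight at least
  \<open>c * \<delta>\<close>.\<close>

lemma concave_decrease:
  fixes w :: "nat \<Rightarrow> real"
  assumes "\<And>j. j \<le> D \<Longrightarrow> \<delta> \<le> w (Suc j) - w j" and "a + c \<le> Suc D"
  shows "w a + real c * \<delta> \<le> w (a + c)"
  using assms(2)
proof (induction c)
  case (Suc c)
  then have "w a + real c * \<delta> \<le> w (a + c)" "\<delta> \<le> w (Suc (a + c)) - w (a + c)"
    using assms(1)[of "a + c"] by auto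
  then show ?case by (simp add: algebra_simps)
qed simp

text \<open>
  Taking a vertex of degree \<open>Suc D\<close> removes \<open>Suc D\<close> edges; by concavity each of the \<open>Suc D * (r - 1)\<close>
  incidences lost at other vertices pays at least \<open>w (Suc D) - w D\<close>.
\<close>

lemma transversal_bound_Suc:
  fixes w :: "nat \<Rightarrow> real"
  assumes fV: "finite V" and base: "transversal_bound V r w D" and w0: "w 0 = 0"
    and concave: "\<And>j. j \<le> D \<Longrightarrow> w (Suc D) - w D \<le> w (Suc j) - w j"
    and gain: "1 \<le> w (Suc D) + real (Suc D * (r - 1)) * (w (Suc D) - w D)"
  shows "transversal_bound V r w (Suc D)"
proof -
  have "\<exists>T\<subseteq>V. (\<forall>e\<in>E. e \<inter> T \<noteq> {}) \<and> real (card T) \<le> (\<Sum>v\<in>V. w (hdeg E v))"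
    if "E \<subseteq> Pow V" "\<forall>e\<in>E. card e = r" "\<forall>v\<in>V. hdeg E v \<le> Suc D" for E
    using that
  proof (induction "card E" arbitrary: E rule: less_induct)
    \<comment> \<open>Induction on the number of edges repeats the greedy choice until no vertex of
      degree \<open>Suc D\<close> is left; then \<open>base\<close> applies.\<close>
    case less
    have fE: "finite E" using less.prems(1) fV by (meson finite_Pow_iff finite_subset)
    show ?case
    proof (cases "\<forall>v\<in>V. hdeg E v \<le> D")
      case True
      with base less.prems show ?thesis unfolding transversal_bound_def by blast
    next
      case False
      then obtain v where v: "v \<in> V" "hdeg E v = Suc D"
        using less.prems(3) by (metis le_SucE)
      define A where "A = {e \<in> E. v \<in> e}"
      define E' where "E' = {e \<in> E. v \<notin> e}"
      define c where "c u = card {e \<in> A. u \<in> e}" for u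
      define \<delta> where "\<delta> = w (Suc D) - w D"
      have fA: "finite A" and cA: "card A = Suc D"
        using fE v(2) by (auto simp: A_def hdeg_def)
      have deg: "hdeg E u = hdeg E' u + c u" for u
      proof -
        have "{e \<in> E. u \<in> e} = {e \<in> E'. u \<in> e} \<union> {e \<in> A. u \<in> e}"
          by (auto simp: A_def E'_def)
        then show ?thesis unfolding hdeg_def c_def
          using fE by (simp add: card_Un_disjoint A_def E'_def disjoint_iff)
      qed
      have "card E' < card E"
      proof (rule psubset_card_mono[OF fE])
        have "A \<noteq> {}" using cA by auto
        then show "E' \<subset> E" by (auto simp: A_def E'_def)
      qed
      moreover have "E' \<subseteq> Pow V" "\<forall>e\<in>E'. card e = r"
        using less.prems by (auto simp: E'_def)
      moreover have "\<forall>u\<in>V. hdeg E' u \<le> Suc D"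
        using less.prems(3) deg by (metis add_leD1)
      ultimately obtain T where T: "T \<subseteq> V" "\<forall>e\<in>E'. e \<inter> T \<noteq> {}"
          "real (card T) \<le> (\<Sum>u\<in>V. w (hdeg E' u))"
        using less.hyps[of E'] by blast
      \<comment> \<open>The incidences lost away from \<open>v\<close>, counted by removed edges:
        each of these has \<open>r - 1\<close> further vertices.\<close>
      have "(\<Sum>u\<in>V - {v}. c u) = (\<Sum>e\<in>A. card {u \<in> V - {v}. u \<in> e})"
        unfolding c_def using fV fA by (intro double_counting) auto
      also have "\<dots> = (\<Sum>e\<in>A. r - 1)"
      proof (rule sum.cong[OF refl])
        fix e assume "e \<in> A"
        then have e: "e \<subseteq> V" "v \<in> e" "card e = r"
          using less.prems by (auto simp: A_def)
        have "{u \<in> V - {v}. u \<in> e} = e - {v}" using e by auto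
        then show "card {u \<in> V - {v}. u \<in> e} = r - 1"
          using e finite_subset[OF e(1) fV] by simp
      qed
      finally have c_sum: "(\<Sum>u\<in>V - {v}. c u) = Suc D * (r - 1)" using cA by simp
      have "hdeg E' v = 0" by (simp add: hdeg_def E'_def)
      then have "(\<Sum>u\<in>V. w (hdeg E' u)) = (\<Sum>u\<in>V - {v}. w (hdeg E' u))"
        using fV v(1) w0 by (simp add: sum.remove)
      also have "\<dots> + real (Suc D * (r - 1)) * \<delta> = (\<Sum>u\<in>V - {v}. w (hdeg E' u) + real (c u) * \<delta>)"
        by (simp only: sum.distrib c_sum[symmetric] of_nat_sum sum_distrib_right)
      also have "\<dots> \<le> (\<Sum>u\<in>V - {v}. w (hdeg E u))"
      proof (rule sum_mono)
        fix u assume "u \<in> V - {v}"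
        then have "hdeg E' u + c u \<le> Suc D" using less.prems(3) deg[of u] by auto
        then show "w (hdeg E' u) + real (c u) * \<delta> \<le> w (hdeg E u)"
          unfolding deg using concave by (intro concave_decrease) (auto simp: \<delta>_def)
      qed
      also have "\<dots> = (\<Sum>u\<in>V. w (hdeg E u)) - w (Suc D)"
        using fV v by (simp add: sum.remove)
      \<comment> \<open>By \<open>gain\<close> the total weight falls by at least 1, which pays for
        putting \<open>v\<close> into the transversal.\<close>
      finally have "(\<Sum>u\<in>V. w (hdeg E' u)) + 1 \<le> (\<Sum>u\<in>V. w (hdeg E u))"
        using gain by (simp add: \<delta>_def)
      moreover have "card (insert v T) \<le> card T + 1"
        by (simp add: card_insert_if finite_subset[OF T(1) fV])
      ultimately have "real (card (insert v T)) \<le> (\<Sum>u\<in>V. w (hdeg E u))"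
        using T(3) by linarith
      moreover have "\<forall>e\<in>E. e \<inter> insert v T \<noteq> {}"
        using T(2) by (auto simp: E'_def)
      ultimately show ?thesis using T(1) v(1) by (intro exI[of _ "insert v T"]) auto
    qed
  qed
  then show ?thesis unfolding transversal_bound_def by blast
qed

section \<open>The base case and the weights for ranks 3 and 4\<close>

lemma transversal_bound_0:
  assumes "finite V" "w 0 = 0" "r > 0"
  shows "transversal_bound V r w 0"
  unfolding transversal_bound_def
proof (intro allI impI)
  fix E assume E: "E \<subseteq> Pow V \<and> (\<forall>e\<in>E. card e = r) \<and> (\<forall>v\<in>V. hdeg E v \<le> 0)"
  have fE: "finite E" using E assms(1) by (meson finite_Pow_iff finite_subset)
  have "E = {}"
  proof (rule ccontr)
    assume "E \<noteq> {}"
    then obtain e where e: "e \<in> E" by auto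
    then have "e \<noteq> {}" using E assms(3) by force
    then obtain v where v: "v \<in> e" by auto
    then have "hdeg E v = 0" using E e by auto
    then show False using e v fE by (auto simp: hdeg_def)
  qed
  then show "\<exists>T\<subseteq>V. (\<forall>e\<in>E. e \<inter> T \<noteq> {}) \<and> real (card T) \<le> (\<Sum>v\<in>V. w (hdeg E v))"
    using assms(2) by (intro exI[of _ "{}"]) (simp add: hdeg_def)
qed

text \<open>Equality in the greedy condition \<open>gain\<close> gives 1/3 and then 7/15. It would
  next allow 19/35; the larger 5/9 keeps the weights concave and suffices for the factor 3/5, since
  3/5 * 5/9 * 3 = 1.\<close>

lemma transversal_bound_3:
  assumes "finite V"
  shows "transversal_bound V 3 (\<lambda>i. [0, 1/3, 7/15, 5/9] ! i) 3"
proof -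
  let ?w = "\<lambda>i. [0, 1/3, 7/15, 5/9 :: real] ! i"
  have 0: "transversal_bound V 3 ?w 0" by (rule transversal_bound_0) (use assms in auto)
  have 1: "transversal_bound V 3 ?w (Suc 0)"
    by (rule transversal_bound_Suc[OF assms 0]) (auto)
  have 2: "transversal_bound V 3 ?w (Suc (Suc 0))"
    by (rule transversal_bound_Suc[OF assms 1]) (auto simp: le_Suc_eq)
  have "transversal_bound V 3 ?w (Suc (Suc (Suc 0)))"
    by (rule transversal_bound_Suc[OF assms 2]) (auto simp: le_Suc_eq)
  then show ?thesis by (simp add: numeral_3_eq_3)
qed

text \<open>The last weight 1/2 is the largest that the factor 1/2 permits. The weight 43/100 is the
  midpoint of 9/25 and 1/2, hence the least one at degree 3 that keeps concavity; the greedy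
  condition alone would accept 53/125.\<close>

lemma transversal_bound_4:
  assumes "finite V"
  shows "transversal_bound V 4 (\<lambda>i. [0, 1/4, 9/25, 43/100, 1/2] ! i) 4"
proof -
  let ?w = "\<lambda>i. [0, 1/4, 9/25, 43/100, 1/2 :: real] ! i"
  have 0: "transversal_bound V 4 ?w 0" by (rule transversal_bound_0) (use assms in auto)
  have 1: "transversal_bound V 4 ?w (Suc 0)"
    by (rule transversal_bound_Suc[OF assms 0]) (auto)
  have 2: "transversal_bound V 4 ?w (Suc (Suc 0))"
    by (rule transversal_bound_Suc[OF assms 1]) (auto simp: le_Suc_eq)
  have 3: "transversal_bound V 4 ?w (Suc (Suc (Suc 0)))"
    by (rule transversal_bound_Suc[OF assms 2]) (auto simp: le_Suc_eq)
  have "transversal_bound V 4 ?w (Suc (Suc (Suc (Suc 0))))"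
    by (rule transversal_bound_Suc[OF assms 3]) (auto simp: le_Suc_eq)
  then show ?thesis by (simp add: eval_nat_numeral)
qed

section \<open>Maximum degree 2: edge covers of the dual multigraph\<close>

text \<open>In the dual the hyperedges are nodes and the vertices of degree 2 are links, possibly
  parallel. A maximum matching \<open>M\<close>, completed by one vertex for each node it misses, is
  a transversal of size at most \<open>card E - card M\<close>. So it suffices that
  \<open>2 * card V2 \<le> 3 * r * card M\<close>.\<close>

lemma max_degree_2_transversal:
  assumes fV: "finite V" and EV: "E \<subseteq> Pow V" and r: "\<forall>e\<in>E. card e = r" "r > 0"
    and deg2: "\<forall>v\<in>V. hdeg E v \<le> 2"
  shows "\<exists>T\<subseteq>V. (\<forall>e\<in>E. e \<inter> T \<noteq> {}) \<and>
           3 * r * card T + 2 * card {v \<in> V. hdeg E v = 2} \<le> 3 * r * card E"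
proof -
  have fE: "finite E" using EV fV by (meson finite_Pow_iff finite_subset)
  have fe: "finite e" if "e \<in> E" for e using that r by (metis card.infinite less_irrefl)
  define V2 where "V2 = {v \<in> V. hdeg E v = 2}"
  define matching where "matching M \<longleftrightarrow> M \<subseteq> V2 \<and> (\<forall>x\<in>M. \<forall>y\<in>M. \<forall>e\<in>E. x \<in> e \<longrightarrow> y \<in> e \<longrightarrow> x = y)" for M
  have fV2: "finite V2" using fV by (simp add: V2_def)
  have card2: "card {e \<in> E. v \<in> e} = 2" if "v \<in> V2" for v
    using that by (simp add: V2_def hdeg_def)
  have edges2: "g = a \<or> g = b"
    if "v \<in> V2" "a \<in> E" "b \<in> E" "a \<noteq> b" "v \<in> a" "v \<in> b" "g \<in> E" "v \<in> g" for v a b g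
  proof -
    have "{a, b} = {e \<in> E. v \<in> e}"
      using that card2[OF that(1)] fE by (intro card_seteq) auto
    then show ?thesis using that(7,8) by blast
  qed
  have "matching {}" by (simp add: matching_def)
  moreover have "\<forall>M. matching M \<longrightarrow> card M < Suc (card V2)"
    using fV2 by (auto simp: matching_def less_Suc_eq_le intro: card_mono)
  ultimately have "\<exists>M. matching M \<and> (\<forall>M'. matching M' \<longrightarrow> card M' \<le> card M)"
    by (rule ex_has_greatest_nat)
  then obtain M where M: "matching M" and M_max: "\<And>M'. matching M' \<Longrightarrow> card M' \<le> card M"
    by metis
  have MV2: "M \<subseteq> V2" and M_inj: "\<And>x y e. x \<in> M \<Longrightarrow> y \<in> M \<Longrightarrow> e \<in> E \<Longrightarrow> x \<in> e \<Longrightarrow> y \<in> e \<Longrightarrow> x = y"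
    using M by (auto simp: matching_def)
  have fM: "finite M" using MV2 fV2 finite_subset by blast
  \<comment> \<open>\<open>H\<close> and \<open>U\<close> are the dual nodes that \<open>M\<close>
    covers and misses.\<close>
  define H where "H = {e \<in> E. e \<inter> M \<noteq> {}}"
  define U where "U = {e \<in> E. e \<inter> M = {}}"
  have HU: "E = H \<union> U" "H \<inter> U = {}" "finite H" "finite U"
    using fE by (auto simp: H_def U_def)
  have cardH: "card H = 2 * card M"
  proof -
    have "(\<Sum>x\<in>M. card {e \<in> H. x \<in> e}) = (\<Sum>e\<in>H. card {x \<in> M. x \<in> e})"
      by (rule double_counting[OF fM HU(3)])
    also have "\<dots> = (\<Sum>e\<in>H. 1)"
    proof (rule sum.cong[OF refl])
      fix e assume e: "e \<in> H"
      then obtain x where "x \<in> M" "x \<in> e" by (auto simp: H_def)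
      then have "{x \<in> M. x \<in> e} = {x}" using e M_inj by (auto simp: H_def)
      then show "card {x \<in> M. x \<in> e} = 1" by simp
    qed
    also have "(\<Sum>x\<in>M. card {e \<in> H. x \<in> e}) = (\<Sum>x\<in>M. 2)"
    proof (rule sum.cong[OF refl])
      fix x assume x: "x \<in> M"
      then have "{e \<in> H. x \<in> e} = {e \<in> E. x \<in> e}" by (auto simp: H_def)
      then show "card {e \<in> H. x \<in> e} = 2" using card2 x MV2 by auto
    qed
    finally show ?thesis by simp
  qed
  \<comment> \<open>A link between two missed nodes could be added to \<open>M\<close>.\<close>
  have U_disj: "card {e \<in> U. v \<in> e} \<le> 1" if v: "v \<in> V2" for v
  proof (rule ccontr)
    assume "\<not> ?thesis"
    then have "{e \<in> U. v \<in> e} = {e \<in> E. v \<in> e}"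
      using fE card2[OF v] by (intro card_seteq) (auto simp: U_def)
    then have no: "\<And>e. e \<in> E \<Longrightarrow> v \<in> e \<Longrightarrow> e \<inter> M = {}" unfolding U_def by blast
    have "{e \<in> E. v \<in> e} \<noteq> {}" using card2[OF v] by (metis card.empty zero_neq_numeral)
    then have "v \<notin> M" using no by blast
    moreover have "matching (insert v M)"
      unfolding matching_def using v MV2 no M_inj by blast
    ultimately show False using M_max[of "insert v M"] fM by simp
  qed
  \<comment> \<open>By \<open>U_disj\<close>, \<open>Z\<close> consists of the links from a missed
    node to a covered one. \<open>Zx x\<close> collects those that end at one of the two nodes
    joined by \<open>x\<close>.\<close>
  define Z where "Z = V2 \<inter> \<Union>U"
  define Zx where "Zx x = {z \<in> Z. \<exists>e\<in>E. x \<in> e \<and> z \<in> e}" for x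
  have "card (Zx x) \<le> r" if x: "x \<in> M" for x
  proof -
    have "card {g \<in> E. x \<in> g} = 2" using x MV2 by (intro card2) auto
    then obtain e f where ef_eq: "{g \<in> E. x \<in> g} = {e, f}" and ef: "e \<noteq> f"
      unfolding card_2_iff by blast
    have "e \<in> {g \<in> E. x \<in> g}" "f \<in> {g \<in> E. x \<in> g}" by (simp_all add: ef_eq)
    then have e: "e \<in> E" "x \<in> e" "e \<notin> U" and f: "f \<in> E" "x \<in> f" "f \<notin> U"
      using x by (auto simp: U_def)
    have "Zx x = {z \<in> Z. \<exists>g\<in>{g \<in> E. x \<in> g}. z \<in> g}" by (auto simp: Zx_def)
    then have Zx_eq: "Zx x = Z \<inter> e \<union> Z \<inter> f" unfolding ef_eq by auto
    \<comment> \<open>Otherwise \<open>u, e, f, u'\<close> is an augmenting path: \<open>x\<close> could be exchanged for \<open>y\<close> and \<open>z\<close>.\<close>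
    have aug: "u = u'"
      if y: "y \<in> Z" "y \<in> e" "u \<in> U" "y \<in> u" and z: "z \<in> Z" "z \<in> f" "u' \<in> U" "z \<in> u'" for y z u u'
    proof (rule ccontr)
      assume ne: "u \<noteq> u'"
      have uE: "u \<in> E" "u' \<in> E" "u \<inter> M = {}" "u' \<inter> M = {}" using y z by (auto simp: U_def)
      have yV: "y \<in> V2" and zV: "z \<in> V2" using y z by (auto simp: Z_def)
      have neq: "e \<noteq> u" "e \<noteq> u'" "f \<noteq> u" "f \<noteq> u'" using e f y z by auto
      have ey: "g = e \<or> g = u" if "g \<in> E" "y \<in> g" for g
        using edges2[OF yV e(1) uE(1) neq(1) y(2,4) that] .
      have ez: "g = f \<or> g = u'" if "g \<in> E" "z \<in> g" for g
        using edges2[OF zV f(1) uE(2) neq(4) z(2,4) that] .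
      have yz: "g \<in> E \<Longrightarrow> y \<in> g \<Longrightarrow> z \<notin> g" for g
        using ey ez ef neq ne by metis
      have ym: "g \<in> E \<Longrightarrow> y \<in> g \<Longrightarrow> g \<inter> (M - {x}) = {}" for g
        using ey[of g] M_inj[OF x _ e(1) e(2)] uE(3) by blast
      have zm: "g \<in> E \<Longrightarrow> z \<in> g \<Longrightarrow> g \<inter> (M - {x}) = {}" for g
        using ez[of g] M_inj[OF x _ f(1) f(2)] uE(4) by blast
      have "matching (insert y (insert z (M - {x})))"
        unfolding matching_def
      proof (intro conjI ballI impI)
        show "insert y (insert z (M - {x})) \<subseteq> V2" using yV zV MV2 by blast
        fix a b g
        assume "a \<in> insert y (insert z (M - {x}))" "b \<in> insert y (insert z (M - {x}))"
          "g \<in> E" "a \<in> g" "b \<in> g"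
        then show "a = b" using yz ym zm M_inj by blast
      qed
      moreover have "y \<noteq> z" "y \<notin> M" "z \<notin> M" using yz[OF uE(1) y(4)] y(4) z(4) uE by auto
      then have "card (insert y (insert z (M - {x}))) = card M + 1"
        using fM card_Suc_Diff1[OF fM x] by (simp del: card_Diff_insert)
      ultimately show False using M_max by fastforce
    qed
    show ?thesis
    \<comment> \<open>If \<open>Z\<close> meets only one of \<open>e\<close> and \<open>f\<close>,
      that hyperedge contains \<open>Zx x\<close>. Otherwise \<open>aug\<close> forces all of
      \<open>Zx x\<close> to end at one common missed node \<open>u\<close>. Either way a single
      hyperedge, of size \<open>r\<close>, contains \<open>Zx x\<close>.\<close>
    proof (cases "Z \<inter> e = {} \<or> Z \<inter> f = {}")
      case True
      then have "Zx x \<subseteq> e \<or> Zx x \<subseteq> f" using Zx_eq by auto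
      then show ?thesis using e f fe r(1) by (metis card_mono)
    next
      case False
      then obtain y z where yz: "y \<in> Z" "y \<in> e" "z \<in> Z" "z \<in> f" by auto
      then obtain u where u: "u \<in> U" "y \<in> u" unfolding Z_def by blast
      have zu: "z' \<in> u" if "z' \<in> Z" "z' \<in> f" for z'
        using aug[OF yz(1,2) u that] that unfolding Z_def by blast
      have "y' \<in> u" if "y' \<in> Z" "y' \<in> e" for y'
        using aug[OF that _ _ yz(3,4) u(1) zu[OF yz(3,4)]] that unfolding Z_def by blast
      then have "Zx x \<subseteq> u" using Zx_eq zu by auto
      then show ?thesis using u fe r(1) HU(1) by (metis UnCI card_mono)
    qed
  qed
  then have "(\<Sum>x\<in>M. card (Zx x)) \<le> r * card M"
    using sum_bounded_above[of M "\<lambda>x. card (Zx x)" r] by (simp add: mult.commute)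
  moreover have "card (\<Union>x\<in>M. Zx x) \<le> (\<Sum>x\<in>M. card (Zx x))" by (rule card_UN_le[OF fM])
  moreover have "card Z \<le> card (\<Union>x\<in>M. Zx x)"
  proof (rule card_mono)
    show "finite (\<Union>x\<in>M. Zx x)" using fM fV2 by (auto simp: Zx_def Z_def)
    show "Z \<subseteq> (\<Union>x\<in>M. Zx x)"
    proof
      fix z assume z: "z \<in> Z"
      then have zV: "z \<in> V2" by (simp add: Z_def)
      \<comment> \<open>At most one of the two hyperedges at \<open>z\<close> is missed by
        \<open>M\<close>, so the other contains some \<open>x\<close> of \<open>M\<close>, and
        \<open>z\<close> lies in \<open>Zx x\<close>.\<close>
      have "card {e \<in> E. z \<in> e} \<noteq> card {e \<in> U. z \<in> e}" using U_disj[OF zV] card2[OF zV] by linarith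
      then have "{e \<in> E. z \<in> e} \<noteq> {e \<in> U. z \<in> e}" by metis
      then obtain g where "g \<in> H" "z \<in> g" using HU(1) by blast
      then show "z \<in> (\<Union>x\<in>M. Zx x)" using z by (auto simp: H_def Zx_def)
    qed
  qed
  ultimately have cardZ: "card Z \<le> r * card M" by linarith
  \<comment> \<open>Each \<open>v\<close> in \<open>V2\<close> has two incidences. Those in
    \<open>H\<close> number at most \<open>r * card H = 2 * r * card M\<close>, those in
    \<open>U\<close> at most \<open>card Z \<le> r * card M\<close>.\<close>
  have "2 * card V2 = (\<Sum>v\<in>V2. card {e \<in> E. v \<in> e})" using card2 by simp
  also have "\<dots> = (\<Sum>e\<in>E. card {v \<in> V2. v \<in> e})" by (rule double_counting[OF fV2 fE])
  also have "\<dots> = (\<Sum>e\<in>H. card {v \<in> V2. v \<in> e}) + (\<Sum>e\<in>U. card {v \<in> V2. v \<in> e})"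
    unfolding HU(1) by (rule sum.union_disjoint) (use HU in auto)
  also have "(\<Sum>e\<in>H. card {v \<in> V2. v \<in> e}) \<le> (\<Sum>e\<in>H. r)"
  proof (rule sum_mono)
    fix e assume "e \<in> H"
    then have "e \<in> E" by (simp add: H_def)
    then show "card {v \<in> V2. v \<in> e} \<le> r" using fe r(1) card_mono[of e "{v \<in> V2. v \<in> e}"] by auto
  qed
  also have "(\<Sum>e\<in>U. card {v \<in> V2. v \<in> e}) = (\<Sum>v\<in>V2. card {e \<in> U. v \<in> e})"
    by (rule double_counting[OF fV2 HU(4), symmetric])
  also have "\<dots> \<le> (\<Sum>v\<in>V2. if v \<in> Z then 1 else 0)"
  proof (rule sum_mono)
    fix v assume v: "v \<in> V2"
    have "{e \<in> U. v \<in> e} = {}" if "v \<notin> Z" using that v by (auto simp: Z_def)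
    then show "card {e \<in> U. v \<in> e} \<le> (if v \<in> Z then 1 else 0)"
      using U_disj[OF v] by (simp del: Collect_empty_eq)
  qed
  also have "\<dots> = card (V2 \<inter> Z)" using fV2 by (simp add: sum.If_cases)
  also have "V2 \<inter> Z = Z" by (auto simp: Z_def)
  finally have V2_le: "2 * card V2 \<le> 3 * r * card M" using cardZ cardH by (simp add: algebra_simps)
  \<comment> \<open>Each missed hyperedge is hit by an arbitrary vertex \<open>h e\<close> of its
    own. As \<open>card H = 2 * card M\<close>, the union with \<open>M\<close> saves
    \<open>card M\<close> against \<open>card E\<close>.\<close>
  have "\<forall>e\<in>U. \<exists>v. v \<in> e" using r by (metis HU(1) UnCI card.empty ex_in_conv less_irrefl)
  then obtain h where h: "\<And>e. e \<in> U \<Longrightarrow> h e \<in> e" by metis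
  have "card (M \<union> h ` U) \<le> card M + card U"
    using card_Un_le[of M "h ` U"] card_image_le[OF HU(4), of h] by linarith
  moreover have "card E = card H + card U" using HU by (simp add: card_Un_disjoint)
  ultimately have "card (M \<union> h ` U) + card M \<le> card E" using cardH by simp
  then have "3 * r * (card (M \<union> h ` U) + card M) \<le> 3 * r * card E" by (rule mult_le_mono2)
  then have "3 * r * card (M \<union> h ` U) + 2 * card V2 \<le> 3 * r * card E"
    using V2_le by (simp only: distrib_left)
  moreover have "M \<union> h ` U \<subseteq> V" using MV2 h EV by (fastforce simp: V2_def U_def)
  moreover have "\<forall>e\<in>E. e \<inter> (M \<union> h ` U) \<noteq> {}"
    using h by (auto simp: U_def disjoint_iff)
  ultimately show ?thesis unfolding V2_def by blast
qed

text \<open>The induction starts at degree 2, with the matching bound. A greedy step there would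
  need weight at least 13/45 at degree 2, while matchings need only 4/15, just below 27/100. The
  last greedy step, from degree 4 to 5, then holds with equality in \<open>gain\<close>.\<close>

lemma transversal_bound_5:
  assumes fV: "finite V"
  shows "transversal_bound V 5 (\<lambda>i. [0, 1/5, 27/100, 33/100, 37/100, 2/5] ! i) 5"
proof -
  let ?w = "\<lambda>i. [0, 1/5, 27/100, 33/100, 37/100, 2/5 :: real] ! i"
  have 2: "transversal_bound V 5 ?w (Suc (Suc 0))"
    unfolding transversal_bound_def
  proof (intro allI impI)
    fix E assume E: "E \<subseteq> Pow V \<and> (\<forall>e\<in>E. card e = 5) \<and> (\<forall>v\<in>V. hdeg E v \<le> Suc (Suc 0))"
    have fE: "finite E" using E fV by (meson finite_Pow_iff finite_subset)
    have deg2: "\<forall>v\<in>V. hdeg E v \<le> 2" using E by (simp add: numeral_2_eq_2)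
    then obtain T where T: "T \<subseteq> V" "\<forall>e\<in>E. e \<inter> T \<noteq> {}"
        "3 * 5 * card T + 2 * card {v \<in> V. hdeg E v = 2} \<le> 3 * 5 * card E"
      using max_degree_2_transversal[of V E 5] E fV by auto
    have "(\<Sum>v\<in>V. hdeg E v) = (\<Sum>e\<in>E. card {v \<in> V. v \<in> e})"
      unfolding hdeg_def by (rule double_counting[OF fV fE])
    also have "\<dots> = (\<Sum>e\<in>E. 5)"
    proof (rule sum.cong[OF refl])
      fix e assume e: "e \<in> E"
      then have "{v \<in> V. v \<in> e} = e" using E by auto
      then show "card {v \<in> V. v \<in> e} = 5" using E e by simp
    qed
    finally have m: "(\<Sum>v\<in>V. real (hdeg E v)) = 5 * real (card E)"
      by (simp flip: of_nat_sum)
    have "real (card T) \<le> real (card E) - 2 / 15 * real (card {v \<in> V. hdeg E v = 2})"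
      using T(3) by linarith
    \<comment> \<open>Since the degrees sum to \<open>5 * card E\<close>, the bound spreads over the
      vertices: 1/5 at degree 1 and 2/5 - 2/15 = 4/15 at degree 2.\<close>
    also have "\<dots> = (\<Sum>v\<in>V. real (hdeg E v) / 5 - 2 / 15 * (if hdeg E v = 2 then 1 else 0))"
      using fV m by (simp add: sum_subtractf sum.If_cases Int_def
          flip: sum_divide_distrib sum_distrib_left)
    also have "\<dots> \<le> (\<Sum>v\<in>V. ?w (hdeg E v))"
    proof (rule sum_mono)
      fix v assume "v \<in> V"
      then have "hdeg E v = 0 \<or> hdeg E v = 1 \<or> hdeg E v = 2" using deg2 by fastforce
      then show "real (hdeg E v) / 5 - 2 / 15 * (if hdeg E v = 2 then 1 else 0) \<le> ?w (hdeg E v)"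
        by auto
    qed
    finally show "\<exists>T\<subseteq>V. (\<forall>e\<in>E. e \<inter> T \<noteq> {}) \<and> real (card T) \<le> (\<Sum>v\<in>V. ?w (hdeg E v))"
      using T by blast
  qed
  have 3: "transversal_bound V 5 ?w (Suc (Suc (Suc 0)))"
    by (rule transversal_bound_Suc[OF assms 2]) (auto simp: le_Suc_eq)
  have 4: "transversal_bound V 5 ?w (Suc (Suc (Suc (Suc 0))))"
    by (rule transversal_bound_Suc[OF assms 3]) (auto simp: le_Suc_eq)
  have "transversal_bound V 5 ?w (Suc (Suc (Suc (Suc (Suc 0)))))"
    by (rule transversal_bound_Suc[OF assms 4]) (auto simp: le_Suc_eq)
  then show ?thesis by (simp add: eval_nat_numeral)
qed

section \<open>Total domination in regular graphs\<close>

lemma finite_total_dominating_sets: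
  assumes "finite V"
  shows "finite {S. total_dominating_set V E S}"
  by (rule finite_subset[of _ "Pow V"]) (use assms in \<open>auto simp: total_dominating_set_def\<close>)

text \<open>A transversal of the family \<open>H\<close> of open neighbourhoods is a total
  dominating set. Regularity makes \<open>H\<close> \<open>d\<close>-uniform with degrees at most
  \<open>d\<close>, so each vertex contributes at most \<open>c\<close>.\<close>

lemma total_domination_number_le:
  assumes G: "simple_graph V E" and reg: "regular V E d"
    and bound: "transversal_bound V d w d" and wc: "\<And>i. i \<le> d \<Longrightarrow> w i \<le> c"
  shows "real (total_domination_number V E) \<le> c * real (card V)"
proof -
  have fV: "finite V" and sym: "\<And>x y. E x y \<Longrightarrow> E y x" using G by (auto simp: simple_graph_def)
  have fN: "finite (nbhd V E v)" for v using fV by (simp add: nbhd_def)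
  define H where "H = nbhd V E ` V"
  have hdeg_le: "hdeg H v \<le> d" if v: "v \<in> V" for v
  proof -
    \<comment> \<open>By symmetry, the open neighbourhoods containing \<open>v\<close> are those of
      the neighbours of \<open>v\<close>.\<close>
    have "{e \<in> H. v \<in> e} \<subseteq> nbhd V E ` nbhd V E v"
      using sym by (auto simp: H_def nbhd_def)
    then have "hdeg H v \<le> card (nbhd V E ` nbhd V E v)"
      unfolding hdeg_def using fN by (intro card_mono) auto
    also have "\<dots> \<le> d" using card_image_le[OF fN] reg v by (metis regular_def)
    finally show ?thesis .
  qed
  have "H \<subseteq> Pow V" "\<forall>e\<in>H. card e = d" using reg by (auto simp: H_def nbhd_def regular_def)
  then obtain T where T: "T \<subseteq> V" "\<forall>e\<in>H. e \<inter> T \<noteq> {}" "real (card T) \<le> (\<Sum>v\<in>V. w (hdeg H v))"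
    using bound hdeg_le unfolding transversal_bound_def by meson
  have "total_dominating_set V E T"
    using T(1,2) by (auto simp: total_dominating_set_def H_def nbhd_def disjoint_iff)
  then have "total_domination_number V E \<le> card T"
    unfolding total_domination_number_def
    using finite_total_dominating_sets[OF fV] by (intro Min_le) auto
  moreover have "(\<Sum>v\<in>V. w (hdeg H v)) \<le> of_nat (card V) * c"
    using wc hdeg_le by (intro sum_bounded_above) auto
  ultimately show ?thesis using T(3) by (simp add: mult.commute)
qed

text \<open>The neighbourhoods of the members of a total dominating set cover \<open>V\<close>, and
  each has \<open>d\<close> elements.\<close>

lemma card_le_total_domination_number:
  assumes G: "simple_graph V E" and reg: "regular V E d" and d: "d > 0"
  shows "card V \<le> d * total_domination_number V E"
proof -
  have fV: "finite V" and sym: "\<And>x y. E x y \<Longrightarrow> E y x" using G by (auto simp: simple_graph_def)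
  \<comment> \<open>As \<open>d > 0\<close>, \<open>V\<close> itself is total dominating, so the
    minimum is taken over a nonempty set and is attained.\<close>
  have "nbhd V E v \<noteq> {}" if "v \<in> V" for v using reg d that by (auto simp: regular_def)
  then have "total_dominating_set V E V"
    by (auto simp: total_dominating_set_def nbhd_def)
  then have "total_domination_number V E \<in> card ` {S. total_dominating_set V E S}"
    unfolding total_domination_number_def
    using finite_total_dominating_sets[OF fV] by (intro Min_in) auto
  then obtain S where S: "total_dominating_set V E S" "total_domination_number V E = card S" by auto
  have SV: "S \<subseteq> V" and fS: "finite S"
    using S(1) fV finite_subset by (auto simp: total_dominating_set_def)
  have "V \<subseteq> (\<Union>s\<in>S. nbhd V E s)"
    using S(1) sym by (fastforce simp: total_dominating_set_def nbhd_def)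
  then have "card V \<le> card (\<Union>s\<in>S. nbhd V E s)"
    using fS fV by (intro card_mono) (auto simp: nbhd_def)
  also have "\<dots> \<le> (\<Sum>s\<in>S. card (nbhd V E s))" by (rule card_UN_le[OF fS])
  also have "\<dots> = (\<Sum>s\<in>S. d)" using reg SV by (intro sum.cong) (auto simp: regular_def)
  finally show ?thesis using S(2) by (simp add: mult.commute)
qed

section \<open>Transfer to covers and the final constants\<close>

lemma regular_cover:
  assumes "is_k_fold_cover k VG EG VF EF" and "regular VF EF d"
  shows "regular VG EG d"
  using assms unfolding is_k_fold_cover_def is_cover_map_def regular_def
  by (metis bij_betw_same_card imageI)

lemma card_cover:
  assumes "is_k_fold_cover k VG EG VF EF" "finite VF" "finite VG"
  shows "card VG = k * card VF"
proof -
  obtain p where p: "p ` VG = VF" "\<forall>u\<in>VF. card {v \<in> VG. p v = u} = k"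
    using assms(1) by (auto simp: is_k_fold_cover_def is_cover_map_def)
  have "(\<Sum>u\<in>VF. card {v \<in> VG. p v = u}) = (\<Sum>v\<in>VG. card {u \<in> VF. p v = u})"
    by (rule double_counting[OF assms(2,3)])
  also have "\<dots> = (\<Sum>v\<in>VG. 1)"
  proof (rule sum.cong[OF refl])
    fix v assume "v \<in> VG"
    then have "{u \<in> VF. p v = u} = {p v}" using p(1) by auto
    then show "card {u \<in> VF. p v = u} = 1" by simp
  qed
  finally show ?thesis using p(2) by (simp add: mult.commute)
qed

text \<open>The cover enters only through its order and its regularity: the upper bound for
  \<open>VF\<close> and the counting bound for \<open>VG\<close> are compared via
  \<open>card VG = k * card VF\<close>. The loss between them is the factor \<open>c * d\<close>,
  which \<open>a\<close> has to absorb.\<close>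

lemma cover_total_domination_number_ge:
  assumes F: "simple_graph VF EF" and G: "simple_graph VG EG"
    and cover: "is_k_fold_cover k VG EG VF EF" and reg: "regular VF EF d" and "d > 0"
    and bound: "transversal_bound VF d w d" and wc: "\<And>i. i \<le> d \<Longrightarrow> w i \<le> c"
    and a: "0 \<le> a" "a * c * real d \<le> 1"
  shows "a * real k * real (total_domination_number VF EF) \<le> real (total_domination_number VG EG)"
proof -
  have fin: "finite VF" "finite VG" using F G by (auto simp: simple_graph_def)
  have "a * real k * real (total_domination_number VF EF) \<le> a * real k * (c * real (card VF))"
    using total_domination_number_le[OF F reg bound wc] a(1) by (intro mult_left_mono) auto
  also have "real d * \<dots> = (a * c * real d) * real (card VG)"
    using card_cover[OF cover fin] by simp
  also have "\<dots> \<le> real (card VG)"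
    using mult_right_mono[OF a(2), of "real (card VG)"] by simp
  also have "\<dots> \<le> real d * real (total_domination_number VG EG)"
    using card_le_total_domination_number[OF G regular_cover[OF cover reg] \<open>d > 0\<close>]
    by (simp flip: of_nat_mult)
  finally show ?thesis using \<open>d > 0\<close> by simp
qed

theorem theorem2p12:
  fixes VF :: "'b set" and EF :: "'b \<Rightarrow> 'b \<Rightarrow> bool"
    and VG :: "'a set" and EG :: "'a \<Rightarrow> 'a \<Rightarrow> bool" and k :: nat
  assumes "simple_graph VF EF" and "simple_graph VG EG"
    and "is_k_fold_cover k VG EG VF EF"
  shows "(regular VF EF 3 \<longrightarrow>
            real (total_domination_number VG EG) \<ge> 3 / 5 * real k * real (total_domination_number VF EF))
       \<and> ((regular VF EF 4 \<or> regular VF EF 5) \<longrightarrow>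
            real (total_domination_number VG EG) \<ge> 1 / 2 * real k * real (total_domination_number VF EF))"
proof -
  have fin: "finite VF" using assms(1) by (simp add: simple_graph_def)
  \<comment> \<open>In all three cases \<open>c\<close> is the weight at degree \<open>d\<close>,
    the largest one, and \<open>a * c * d = 1\<close> exactly: 3/5 * 5/9 * 3, 1/2 * 1/2 * 4 and 1/2
    * 2/5 * 5.\<close>
  have "3 / 5 * real k * real (total_domination_number VF EF) \<le> real (total_domination_number VG EG)"
    if "regular VF EF 3"
    by (rule cover_total_domination_number_ge[OF assms that _ transversal_bound_3[OF fin], where c = "5/9"])
      (auto simp: numeral_3_eq_3 le_Suc_eq)
  moreover have "1 / 2 * real k * real (total_domination_number VF EF) \<le> real (total_domination_number VG EG)"
    if "regular VF EF 4"
    by (rule cover_total_domination_number_ge[OF assms that _ transversal_bound_4[OF fin], where c = "1/2"])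
      (auto simp: eval_nat_numeral le_Suc_eq)
  moreover have "1 / 2 * real k * real (total_domination_number VF EF) \<le> real (total_domination_number VG EG)"
    if "regular VF EF 5"
    by (rule cover_total_domination_number_ge[OF assms that _ transversal_bound_5[OF fin], where c = "2/5"])
      (auto simp: eval_nat_numeral le_Suc_eq)
  ultimately show ?thesis by blast
qed

end
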